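(* Let $(Q_k)_{k\ge 0}$ be the Pell–Lucas sequence. If there exist integers $k\ge 0$, $n\ge 2$, $m\ge 1$ and digits $a_1,a_2\in\{1,\ldots,9\}$ such that $$Q_k=a_1\cdot\frac{10^n-1}{9}-a_2\cdot\frac{10^m-1}{9},$$ then $Q_k\in\{2,5,6,14,34,82,478\}$. Moreover the following representations hold: $2=11-9$, $6=11-5$, $14=22-8$, $34=111-77$, $82=88-6$, $478=555-77$.
   Context: The Pell–Lucas numbers are defined by $Q_0=Q_1=2$ and $Q_{k+2}=2Q_{k+1}+Q_k$ for all $k\ge 0$. A repdigit is a positive integer of the form $a\cdot\frac{10^m-1}{9}$ with $m\ge 1$ and $a\in\{1,\ldots,9\}$, i.e. all of whose decimal digits are equal. *)

theory Defs
  imports Complex_Main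
begin

fun pell_lucas :: "nat \<Rightarrow> int" where
  "pell_lucas 0 = 2"
| "pell_lucas (Suc 0) = 2"
| "pell_lucas (Suc (Suc k)) = 2 * pell_lucas (Suc k) + pell_lucas k"

definition repdigit :: "int \<Rightarrow> nat \<Rightarrow> int" where
  "repdigit a m = a * ((10 ^ m - 1) div 9)"

text \<open>The integer division in the definition of \<^const>\<open>repdigit\<close> is exact:\<close>

lemma nine_times_repdigit: "9 * repdigit a m = a * (10 ^ m - 1)"
proof -
  have "(9::int) dvd 10 ^ m - 1"
  proof (induction m)
    case (Suc m)
    have "(10::int) ^ Suc m - 1 = 9 * 10 ^ m + (10 ^ m - 1)"
      by simp
    with Suc show ?case
      by (metis dvd_add dvd_triv_left)
  qed simp
  then show ?thesis
    by (simp add: repdigit_def)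
qed

end

theory Submission imports Defs
begin

text \<open>
  The equation reads \<open>9 Q\<^sub>k = a\<^sub>1 10\<^sup>n - a\<^sub>2 10\<^sup>m - a\<^sub>1 + a\<^sub>2\<close>. For \<open>n \<ge> 4\<close> the term
  \<open>a\<^sub>1 10\<^sup>n\<close> vanishes modulo 2000, so \<open>a\<^sub>1\<close> is determined modulo 2000 by \<open>Q\<^sub>k\<close>, \<open>a\<^sub>2\<close> and
  \<open>min m 4\<close>. Since \<open>a\<^sub>1\<close> is a digit, only twenty combinations of \<open>k\<close> modulo 300, \<open>a\<^sub>1\<close>, \<open>a\<^sub>2\<close>
  and \<open>m\<close> survive, all with \<open>m \<le> 2\<close>. Then \<open>10\<^sup>n \<equiv> (9 Q\<^sub>k + a\<^sub>1 + a\<^sub>2 (10\<^sup>m - 1)) / a\<^sub>1\<close> is known modulo the primes 751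
  and 31, for which the period of \<open>Q\<close> divides 300, and in each case it fails to lie in the
  subgroup generated by 10 modulo one of them. These subgroups are small: 10 has order 125
  modulo 751 and order 15 modulo 31. If \<open>n \<le> 3\<close>, then \<open>Q\<^sub>k \<le> 999\<close> and \<open>k \<le> 7\<close>.
\<close>

lemma pell_lucas_mod_step:
  "pell_lucas (Suc (Suc k)) mod M = (2 * (pell_lucas (Suc k) mod M) + pell_lucas k mod M) mod M"
  by (metis mod_add_left_eq mod_add_right_eq mod_mult_right_eq pell_lucas.simps(3))

text \<open>The base case demands a return to the initial pair, so one evaluation certifies both
  \<open>P\<close> along the run and periodicity.\<close>

primrec pell_lucas_cycle :: "(int \<Rightarrow> bool) \<Rightarrow> int \<Rightarrow> nat \<Rightarrow> int \<Rightarrow> int \<Rightarrow> bool" where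
  "pell_lucas_cycle P M 0 x y \<longleftrightarrow> x = 2 \<and> y = 2"
| "pell_lucas_cycle P M (Suc i) x y \<longleftrightarrow> P x \<and> pell_lucas_cycle P M i y ((2 * y + x) mod M)"

lemma pell_lucas_cycleD:
  assumes "pell_lucas_cycle P M i (pell_lucas k mod M) (pell_lucas (Suc k) mod M)"
  shows "(\<forall>j<i. P (pell_lucas (k + j) mod M)) \<and>
    pell_lucas (k + i) mod M = 2 \<and> pell_lucas (Suc (k + i)) mod M = 2"
  using assms
proof (induction i arbitrary: k)
  case 0
  then show ?case by simp
next
  case (Suc i)
  have "pell_lucas_cycle P M i (pell_lucas (Suc k) mod M) (pell_lucas (Suc (Suc k)) mod M)"
    using Suc.prems unfolding pell_lucas_mod_step by simp
  from Suc.IH[OF this] Suc.prems show ?case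
    by (auto simp: less_Suc_eq_0_disj)
qed

text \<open>Two consecutive residues determine all later ones, so the \<open>T\<close> tested
  residues repeat forever.\<close>

lemma pell_lucas_cycle_all:
  assumes "pell_lucas_cycle P M T 2 2" "T > 0" "M > 2"
  shows "P (pell_lucas k mod M)"
proof -
  have cyc: "(\<forall>j<T. P (pell_lucas j mod M)) \<and>
      pell_lucas T mod M = 2 \<and> pell_lucas (Suc T) mod M = 2"
    using pell_lucas_cycleD[of P M T 0] assms by simp
  have shift: "pell_lucas (T + j) mod M = pell_lucas j mod M \<and>
      pell_lucas (Suc (T + j)) mod M = pell_lucas (Suc j) mod M" for j
  proof (induction j)
    case 0
    then show ?case using cyc assms(3) by simp
  next
    case (Suc j)
    then show ?case
      using pell_lucas_mod_step[of "T + j" M] pell_lucas_mod_step[of j M]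
      by (simp del: pell_lucas.simps)
  qed
  show ?thesis
  proof (induction k rule: less_induct)
    case (less k)
    show ?case
    proof (cases "k < T")
      case False
      then have "pell_lucas k mod M = pell_lucas (k - T) mod M"
        using shift[of "k - T"] by simp
      moreover have "k - T < k" using False assms(2) by simp
      ultimately show ?thesis using less.IH by metis
    qed (use cyc in simp)
  qed
qed

text \<open>Iterated fifth powers keep the intermediate numbers small during evaluation.\<close>

definition pow125_mod_751 :: "int \<Rightarrow> int" where
  "pow125_mod_751 x = (((x mod 751) ^ 5 mod 751) ^ 5 mod 751) ^ 5 mod 751"

lemma pow125_mod_751_eq: "pow125_mod_751 x = x ^ 125 mod 751"
  unfolding pow125_mod_751_def power_mod by (simp flip: power_mult)

text \<open>The residue \<open>v\<close> is taken modulo \<open>46562000 = 2000 * 751 * 31\<close>; \<open>b\<close> is the digit \<open>a\<^sub>2\<close>, and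
  \<open>a\<close> is the value forced upon \<open>a\<^sub>1\<close> by the congruence modulo 2000. Here \<open>m\<close> stands for
  \<open>min m 4\<close>, since \<open>10\<^sup>m\<close> vanishes modulo 2000 from \<open>m = 4\<close> on.\<close>

definition no_solution_residue :: "int \<Rightarrow> bool" where
  "no_solution_residue v \<longleftrightarrow>
    (let w = 9 * v mod 2000 in list_all (\<lambda>m. list_all (\<lambda>b.
      let d = b * (10 ^ m - 1); a = (- d - w) mod 2000 in
      if 1 \<le> a \<and> a \<le> 9
      then m \<le> 2 \<and> (pow125_mod_751 (9 * v + a + d) \<noteq> pow125_mod_751 a \<or>
                    ((9 * v + a + d) mod 31) ^ 15 mod 31 \<noteq> a ^ 15 mod 31)
      else True) [1, 2, 3, 4, 5, 6, 7, 8, 9]) [1, 2, 3, 4])"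

text \<open>300 is a common period modulo 2000, 751 and 31.\<close>

lemma cycle_no_solution: "pell_lucas_cycle no_solution_residue 46562000 300 2 2"
  by code_simp

text \<open>Raising to the power \<open>t\<close> removes the factor \<open>10 ^ n\<close>, giving a
  test independent of the unknown \<open>n\<close>.\<close>

lemma power_order_mod:
  fixes a x p :: int
  assumes "x mod p = (a * 10 ^ n) mod p" "10 ^ t mod p = 1 mod p"
  shows "x ^ t mod p = a ^ t mod p"
proof -
  have "x ^ t mod p = (a * 10 ^ n) ^ t mod p"
    by (metis assms(1) power_mod)
  also have "\<dots> = (a ^ t * (10 ^ t) ^ n) mod p"
    by (simp add: power_mult_distrib mult.commute flip: power_mult)
  also have "\<dots> = (a ^ t * (1 ^ n)) mod p"
    by (metis assms(2) mod_mult_right_eq power_mod)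
  finally show ?thesis by simp
qed

lemma no_solution_large:
  fixes a b :: int
  assumes n: "n \<ge> 4" and m: "m \<ge> 1" and ab: "a \<in> {1..9}" "b \<in> {1..9}"
    and eq: "pell_lucas k = repdigit a n - repdigit b m"
  shows False
proof -
  define v where "v = pell_lucas k mod 46562000"
  define m' where "m' = min m 4"
  define d where "d = b * (10 ^ m' - 1)"
  have eq9: "9 * pell_lucas k = a * 10 ^ n - a - b * 10 ^ m + b"
    using eq nine_times_repdigit[of a n] nine_times_repdigit[of b m] by (simp add: algebra_simps)
  have dvd: "(2000::int) dvd 10 ^ j" if "j \<ge> 4" for j
  proof -
    have "(2000::int) dvd 10 ^ 4" by simp
    then show ?thesis using le_imp_power_dvd[OF that] by (rule dvd_trans)
  qed
  obtain q where q: "pell_lucas k = v + 46562000 * q"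
    by (metis v_def mod_mult_div_eq)
  \<comment> \<open>For \<open>m > 4\<close> both powers are multiples of 2000; otherwise they
    coincide.\<close>
  have "(2000::int) dvd b * (10 ^ m - 10 ^ m')"
  proof (cases "m \<le> 4")
    case False
    then show ?thesis using dvd[of m] by (simp add: m'_def)
  qed (simp add: m'_def)
  moreover have "(2000::int) dvd a * 10 ^ n" using dvd[OF n] by simp
  moreover have "(2000::int) dvd 9 * (46562000 * q)" by simp
  ultimately have "2000 dvd a * 10 ^ n - b * (10 ^ m - 10 ^ m') - 9 * (46562000 * q)"
    by (intro dvd_diff)
  also have "a * 10 ^ n - b * (10 ^ m - 10 ^ m') - 9 * (46562000 * q) = a - (- d - 9 * v)"
    using eq9 q by (simp add: d_def algebra_simps)
  finally have "a mod 2000 = (- d - 9 * v) mod 2000"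
    by (metis mod_eq_dvd_iff)
  then have a: "(- d - 9 * v) mod 2000 = a" using ab by simp
  have "no_solution_residue v"
    using pell_lucas_cycle_all[OF cycle_no_solution] by (simp add: v_def)
  moreover have "m' \<in> set [1, 2, 3, 4]" using m by (auto simp: m'_def)
  moreover have "b \<in> set [1, 2, 3, 4, 5, 6, 7, 8, 9]" using ab by auto
  ultimately have "let d = b * (10 ^ m' - 1); a = (- d - 9 * v mod 2000) mod 2000 in
      if 1 \<le> a \<and> a \<le> 9
      then m' \<le> 2 \<and> (pow125_mod_751 (9 * v + a + d) \<noteq> pow125_mod_751 a \<or>
                    ((9 * v + a + d) mod 31) ^ 15 mod 31 \<noteq> a ^ 15 mod 31)
      else True"
    unfolding no_solution_residue_def list_all_iff Let_def[of "9 * v mod 2000"] by blast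
  then have *: "m' \<le> 2"
    "(9 * v + a + d) ^ 125 mod 751 \<noteq> a ^ 125 mod 751 \<or> (9 * v + a + d) ^ 15 mod 31 \<noteq> a ^ 15 mod 31"
    using ab unfolding d_def[symmetric] Let_def mod_diff_right_eq a pow125_mod_751_eq power_mod
    by simp_all
  \<comment> \<open>The cap at 4 is inactive, so \<open>d\<close> is exact and also usable modulo
    751 and 31.\<close>
  have "m' = m" using *(1) by (simp add: m'_def min_def split: if_splits)
  then have X: "9 * v + a + d = a * 10 ^ n - 9 * (46562000 * q)"
    using eq9 q by (simp add: d_def algebra_simps)
  have "(9 * v + a + d) mod p = (a * 10 ^ n) mod p" if "p dvd 46562000" for p
  proof -
    have "p dvd 9 * (46562000 * q)" using that by (simp only: dvd_mult dvd_mult2)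
    then show ?thesis unfolding X by (simp only: mod_eq_dvd_iff) simp
  qed
  then have "(9 * v + a + d) mod 751 = (a * 10 ^ n) mod 751"
    and "(9 * v + a + d) mod 31 = (a * 10 ^ n) mod 31" by simp_all
  from this[THEN power_order_mod, of 125] this[THEN power_order_mod, of 15] *(2)
  show False by simp
qed

lemma pell_lucas_pos: "pell_lucas k > 0"
  by (induction k rule: pell_lucas.induct) auto

lemma pell_lucas_le_Suc: "pell_lucas k \<le> pell_lucas (Suc k)"
proof (cases k)
  case (Suc j)
  then show ?thesis using pell_lucas_pos[of j] pell_lucas_pos[of k] by simp
qed simp

lemma repdigit_ge_1111:
  assumes "b \<ge> 1" "m \<ge> 4"
  shows "repdigit b m \<ge> 1111"
proof -
  have "(10::int) ^ 4 \<le> 10 ^ m" using assms(2) by (intro power_increasing) auto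
  then have "1 * 9999 \<le> b * ((10::int) ^ m - 1)" using assms(1) by (intro mult_mono) auto
  then show ?thesis using nine_times_repdigit[of b m] by simp
qed

lemma solution_small:
  fixes a b :: int
  assumes n: "n = 2 \<or> n = 3" and m: "m \<ge> 1" and ab: "a \<in> {1..9}" "b \<in> {1..9}"
    and eq: "pell_lucas k = repdigit a n - repdigit b m"
  shows "pell_lucas k \<in> {2, 6, 14, 34, 82, 478}"
proof -
  have vals: "pell_lucas 2 = 6" "pell_lucas 3 = 14" "pell_lucas 4 = 34" "pell_lucas 5 = 82"
    "pell_lucas 6 = 198" "pell_lucas 7 = 478" "pell_lucas 8 = 1154"
    by (simp_all add: eval_nat_numeral)
  have a_le: "repdigit a n = 11 * a \<or> repdigit a n = 111 * a"
    using n by (auto simp: repdigit_def)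
  have b_cases: "repdigit b m = b \<or> repdigit b m = 11 * b \<or> repdigit b m = 111 * b \<or>
      repdigit b m \<ge> 1111"
  proof (cases "m \<ge> 4")
    case False
    then have "m = 1 \<or> m = 2 \<or> m = 3" using m by auto
    then show ?thesis by (auto simp: repdigit_def)
  qed (use repdigit_ge_1111 ab in auto)
  have "k < 8"
  proof (rule ccontr)
    assume "\<not> k < 8"
    then have "pell_lucas 8 \<le> pell_lucas k"
      using lift_Suc_mono_le[of pell_lucas, OF pell_lucas_le_Suc, of 8 k] by simp
    then show False using vals(7) eq a_le b_cases ab by auto
  qed
  \<comment> \<open>For \<open>k < 8\<close> only \<open>pell_lucas 6 = 198\<close> lies outside the
    list.\<close>
  moreover have "k \<noteq> 6"
  proof
    assume "k = 6"
    then have sum: "repdigit b m + 198 = repdigit a n" using eq vals by simp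
    have bounds: "1 \<le> a" "a \<le> 9" "1 \<le> b" "b \<le> 9" using ab by auto
    \<comment> \<open>\<open>11 * a \<le> 99\<close> is too small, and a subtrahend of at least 1111
      too large.\<close>
    consider "b + 198 = 111 * a" | "11 * b + 198 = 111 * a" | "111 * b + 198 = 111 * a"
      using bounds sum a_le b_cases by linarith
    then show False
    proof cases
      case 1
      \<comment> \<open>\<open>b + 198\<close> lies strictly between 111 and 222.\<close>
      moreover have "a \<le> 1 \<or> a \<ge> 2" by linarith
      ultimately show False using bounds by linarith
    next
      case 2
      then have "a = 11 * (b + 18 - 10 * a)" by simp
      then have "11 dvd a" by (rule dvdI)
      then show False using zdvd_imp_le[of 11 a] bounds by simp
    next
      case 3
      then have "37 * (a - b) = 66" by simp
      then show False by presburger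
    qed
  qed
  ultimately have "k = 0 \<or> k = 1 \<or> k = 2 \<or> k = 3 \<or> k = 4 \<or> k = 5 \<or> k = 7" by arith
  then show ?thesis using vals by auto
qed

theorem theorem2:
  "(\<forall>(k::nat) (n::nat) (m::nat) (a1::int) (a2::int).
      n \<ge> 2 \<and> m \<ge> 1 \<and> a1 \<in> {1..9} \<and> a2 \<in> {1..9} \<and>
      pell_lucas k = repdigit a1 n - repdigit a2 m \<longrightarrow>
      pell_lucas k \<in> {2, 5, 6, 14, 34, 82, 478}) \<and>
   (pell_lucas 0 = 2 \<and> (2::int) = 11 - 9 \<and> 11 = repdigit 1 2 \<and> 9 = repdigit 9 1) \<and>
   (pell_lucas 2 = 6 \<and> (6::int) = 11 - 5 \<and> 11 = repdigit 1 2 \<and> 5 = repdigit 5 1) \<and>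
   (pell_lucas 3 = 14 \<and> (14::int) = 22 - 8 \<and> 22 = repdigit 2 2 \<and> 8 = repdigit 8 1) \<and>
   (pell_lucas 4 = 34 \<and> (34::int) = 111 - 77 \<and> 111 = repdigit 1 3 \<and> 77 = repdigit 7 2) \<and>
   (pell_lucas 5 = 82 \<and> (82::int) = 88 - 6 \<and> 88 = repdigit 8 2 \<and> 6 = repdigit 6 1) \<and>
   (pell_lucas 7 = 478 \<and> (478::int) = 555 - 77 \<and> 555 = repdigit 5 3 \<and> 77 = repdigit 7 2)"
  (is "?main \<and> ?examples")
proof
  show ?main
  proof (intro allI impI, elim conjE)
    fix k n m :: nat and a1 a2 :: int
    assume *: "2 \<le> n" "1 \<le> m" "a1 \<in> {1..9}" "a2 \<in> {1..9}"
      "pell_lucas k = repdigit a1 n - repdigit a2 m"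
    have "n < 4" using no_solution_large[of n m a1 a2 k] * by force
    then have "n = 2 \<or> n = 3" using *(1) by auto
    from solution_small[OF this *(2-5)] show "pell_lucas k \<in> {2, 5, 6, 14, 34, 82, 478}" by auto
  qed
  show ?examples
    by (simp add: repdigit_def eval_nat_numeral)
qed

end
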